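(* Consider the SAMBA algorithm with step size $\alpha\in(0,1)$ satisfying $\alpha<\frac{\Delta}{r^*-\Delta}$, run on a $K$-armed Bernoulli bandit instance with a unique optimal arm against an adaptive adversary with corruption budget $C\ge 0$ (setting described in the context). Then there exist constants $c_1,c_2>0$ depending only on $K$, $\boldsymbol r$ and $\alpha$ (and not on $T$, $C$, or the adversary's strategy) such that for every horizon $T\ge 2$, $$Rg(T)\le c_1\,\frac{K}{\Delta}\log T+c_2\,\frac{C}{\Delta},$$ i.e. $Rg(T)=O\!\left(\frac{K}{\Delta}\log T+\frac{C}{\Delta}\right)$.
   Context: Setting. There are $K$ arms $\mathcal A=\{1,\dots,K\}$ with expected rewards $\boldsymbol r=(r_1,\dots,r_K)\in[0,1]^K$. There is a unique optimal arm $a^*=\arg\max_a r_a$; write $r^*=r_{a^*}$, $\Delta_a=r^*-r_a>0$ for $a\ne a^*$, and $\Delta=\min_{a\ne a^*}\Delta_a$. Rounds are indexed $t=0,1,2,\dots$. Adversary. In each round $t$, knowing the past history $H(t-1)$ of pulled arms and observed rewards and the algorithm's current distribution $p(t)$ (but not the arm $a(t)$ that will be drawn), the adversary chooses corrupted means $\boldsymbol r'(t)\in[0,1]^K$ at cost $c(t)=\max_{a}|r_a-r'_a(t)|$, subject to $\sum_t c(t)\le C$. If arm $a(t)$ is pulled, the observed reward $R(t)\in\{0,1\}$ is drawn from a Bernoulli distribution with mean $r'_{a(t)}(t)$, independently given the past. SAMBA. The algorithm maintains a probability vector $p(t)=(p_1(t),\dots,p_K(t))$ with $p_a(0)=1/K$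 for all $a$. In round $t$: let the leading arm be $a_l=a_l(t)\in\arg\max_a p_a(t)$ (ties broken arbitrarily); draw $a(t)\sim p(t)$ and observe $R(t)$; for every $a\ne a_l$ set $$p_a(t+1)=p_a(t)+\alpha\,p_a(t)^2\left(\frac{R(t)\mathbb 1[a(t)=a]}{p_a(t)}-\frac{R(t)\mathbb 1[a(t)=a_l]}{p_{a_l}(t)}\right),$$ and set $p_{a_l}(t+1)=1-\sum_{a\ne a_l}p_a(t+1)$. Regret: $Rg(T)=\sum_{a\ne a^*}\Delta_a\,\mathbb E\left[\sum_{t=0}^{T-1}p_a(t)\right]$ (true, uncorrupted means are used). *)

theory Defs
  imports "HOL-Probability.Probability"
begin

text \<open>Arms are the natural numbers 1..K. A history is the chronological list of
  (pulled arm, observed reward) pairs; the reward is Bernoulli, encoded as bool.\<close>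

type_synonym history = "(nat \<times> bool) list"

definition arms :: "nat \<Rightarrow> nat set" where
  "arms K = {1..K}"

text \<open>One SAMBA update: leading arm l, current probabilities p, pulled arm b, reward R.\<close>
definition samba_nonlead :: "real \<Rightarrow> nat \<Rightarrow> (nat \<Rightarrow> real) \<Rightarrow> nat \<Rightarrow> bool \<Rightarrow> nat \<Rightarrow> real" where
  "samba_nonlead \<alpha> l p b R a =
     p a + \<alpha> * (p a)^2 * ((of_bool R * of_bool (b = a)) / p a - (of_bool R * of_bool (b = l)) / p l)"

definition samba_update :: "real \<Rightarrow> nat \<Rightarrow> nat \<Rightarrow> (nat \<Rightarrow> real) \<Rightarrow> nat \<Rightarrow> bool \<Rightarrow> (nat \<Rightarrow> real)" where
  "samba_update \<alpha> K l p b R = (\<lambda>a.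
     if a \<notin> arms K then 0
     else if a = l then 1 - (\<Sum>a'\<in>arms K - {l}. samba_nonlead \<alpha> l p b R a')
     else samba_nonlead \<alpha> l p b R a)"

text \<open>Probability vector after a history, given on the reversed history (newest first).
  The tie-breaking rule tb may depend on the (chronological) history and on p.\<close>
fun samba_probs_rev :: "real \<Rightarrow> nat \<Rightarrow> (history \<Rightarrow> (nat \<Rightarrow> real) \<Rightarrow> nat) \<Rightarrow> history \<Rightarrow> (nat \<Rightarrow> real)" where
  "samba_probs_rev \<alpha> K tb [] = (\<lambda>a. if a \<in> arms K then 1 / real K else 0)"
| "samba_probs_rev \<alpha> K tb ((b, R) # hs) =
     (let p = samba_probs_rev \<alpha> K tb hs in samba_update \<alpha> K (tb (rev hs) p) p b R)"

definition samba_probs :: "real \<Rightarrow> nat \<Rightarrow> (history \<Rightarrow> (nat \<Rightarrow> real) \<Rightarrow> nat) \<Rightarrow> history \<Rightarrow> (nat \<Rightarrow> real)" where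
  "samba_probs \<alpha> K tb h = samba_probs_rev \<alpha> K tb (rev h)"

text \<open>Distribution of the history after n rounds, against adversary adv, which maps the
  past history to the corrupted mean vector r'(t) (p(t) is a function of the history).\<close>
fun samba_hist :: "real \<Rightarrow> nat \<Rightarrow> (history \<Rightarrow> (nat \<Rightarrow> real) \<Rightarrow> nat) \<Rightarrow> (history \<Rightarrow> nat \<Rightarrow> real)
      \<Rightarrow> nat \<Rightarrow> history pmf" where
  "samba_hist \<alpha> K tb adv 0 = return_pmf []"
| "samba_hist \<alpha> K tb adv (Suc n) =
     bind_pmf (samba_hist \<alpha> K tb adv n) (\<lambda>h.
       bind_pmf (embed_pmf (samba_probs \<alpha> K tb h)) (\<lambda>b.
         map_pmf (\<lambda>R. h @ [(b, R)]) (bernoulli_pmf (adv h b))))"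

definition corruption_cost :: "nat \<Rightarrow> (nat \<Rightarrow> real) \<Rightarrow> (nat \<Rightarrow> real) \<Rightarrow> real" where
  "corruption_cost K r r' = Max ((\<lambda>a. \<bar>r a - r' a\<bar>) ` arms K)"

definition samba_regret :: "real \<Rightarrow> nat \<Rightarrow> (history \<Rightarrow> (nat \<Rightarrow> real) \<Rightarrow> nat) \<Rightarrow> (history \<Rightarrow> nat \<Rightarrow> real)
      \<Rightarrow> (nat \<Rightarrow> real) \<Rightarrow> nat \<Rightarrow> nat \<Rightarrow> real" where
  "samba_regret \<alpha> K tb adv r astar T =
     (\<Sum>a\<in>arms K - {astar}. (r astar - r a) *
        measure_pmf.expectation (samba_hist \<alpha> K tb adv T)
          (\<lambda>h. \<Sum>t<T. samba_probs \<alpha> K tb (take t h) a))"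

end

theory Submission
  imports Defs
begin

text \<open>Write \<open>s\<close> for the optimal arm and \<open>D\<close> for the minimal gap. The argument is a drift analysis
  of the potential \<open>V p = A (1 / p s - B p s) + (\<Sum>a \<noteq> s. ln (p a))\<close>.
  When \<open>s\<close> leads, each \<open>ln (p a)\<close> has drift at most \<open>- \<alpha> D (p a)\<close>, and the increase of \<open>1 / p s\<close>
  is of order \<open>\<Sum>a \<noteq> s. (p a)\<^sup>2\<close>, which the positive drift of \<open>p s\<close> absorbs. When \<open>s\<close> does not lead,
  the step size condition puts the drift of \<open>1 / p s\<close> below a negative constant, up to
  \<open>O(p s)\<close>, hence up to \<open>O((p s)\<^sup>2)\<close>, which is again absorbed by \<open>p s\<close>. So \<open>V\<close> decreases in
  expectation by at least \<open>\<alpha> D (1 - p s)\<close>, up to a multiple of the corruption of the round.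
  Deterministically \<open>p a \<ge> (1 - \<alpha>) / (K (n + 1))\<close> after \<open>n\<close> rounds, whatever the adversary does,
  so \<open>V\<close> stays above \<open>- O(log n)\<close>, and telescoping gives the bound.\<close>

section \<open>One SAMBA step\<close>

locale samba_env =
  fixes \<alpha> :: real and K :: nat and r :: "nat \<Rightarrow> real" and s :: nat and D :: real
  assumes \<alpha>: "0 < \<alpha>" "\<alpha> < 1"
    and star: "s \<in> arms K"
    and r_range: "\<And>a. a \<in> arms K \<Longrightarrow> 0 \<le> r a" "\<And>a. a \<in> arms K \<Longrightarrow> r a \<le> 1"
    and gap: "\<And>a. a \<in> arms K \<Longrightarrow> a \<noteq> s \<Longrightarrow> r a + D \<le> r s"
    and D: "0 < D" "\<alpha> * (r s - D) < D"
begin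

text \<open>When \<open>s\<close> does not lead and \<open>p s\<close> is tiny, the uncorrupted
  drift of \<open>1 / p s\<close> is at most \<open>- \<alpha> * slack\<close>:
  \<open>r s / (1 + \<alpha>)\<close> comes from rewarded pulls of \<open>s\<close>, and
  \<open>r s - D\<close> bounds the mean of the leader. The step size condition is equivalent to its
  positivity.\<close>

definition slack :: real where
  "slack = r s / (1 + \<alpha>) - (r s - D)"

text \<open>The first summand absorbs the growth of \<open>1 / p s\<close> while \<open>s\<close>
  leads. The second is the coefficient of \<open>(p s)^2\<close> left after splitting the linear
  error \<open>\<alpha> * K / (1 - \<alpha>) * p s\<close> against \<open>slack / 2\<close>. The
  division by \<open>D\<close> is there because the drift of \<open>p s\<close> is only
  \<open>\<alpha> * D\<close> times a square.\<close>

definition coefB :: real where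
  "coefB = (K\<^sup>2 / (1 - \<alpha>) + (\<alpha> * K / (1 - \<alpha>))\<^sup>2 / (2 * slack)) / D"

text \<open>Solves \<open>coefA * (\<alpha> * slack / 2) = K^2 + \<alpha> * D\<close>: half of the
  slack pays for the crude bound \<open>K^2\<close> on the drift of the logarithms and still leaves
  \<open>\<alpha> * D\<close>.\<close>

definition coefA :: real where
  "coefA = (K\<^sup>2 + \<alpha> * D) / (\<alpha> * slack / 2)"

definition potential :: "(nat \<Rightarrow> real) \<Rightarrow> real" where
  "potential q = coefA * (1 / q s - coefB * q s) + (\<Sum>a\<in>arms K - {s}. ln (q a))"

text \<open>The summand 2 covers corruption in the logarithmic part; the rest covers corruption in
  the drifts of \<open>1 / p s\<close> and of \<open>p s\<close>, scaled by \<open>coefA\<close> and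
  \<open>coefA * coefB\<close>.\<close>

definition cost_rate :: real where
  "cost_rate = 2 + 2 * coefA * (1 + coefB)"

lemma slack_pos: "0 < slack"
  using D \<alpha> by (simp add: slack_def field_simps)

lemma coef_pos: "0 \<le> coefB" "0 < coefA"
  using slack_pos D \<alpha> by (auto simp: coefA_def coefB_def add_nonneg_pos)

lemma cost_rate_pos: "0 < cost_rate"
  using coef_pos by (simp add: cost_rate_def add_pos_nonneg)

end

section \<open>Pathwise effect of a single update\<close>

locale samba_step =
  fixes \<alpha> :: real and K l :: nat and p :: "nat \<Rightarrow> real"
  assumes \<alpha>: "0 < \<alpha>" "\<alpha> < 1"
    and lead: "l \<in> arms K" "\<And>a. a \<in> arms K \<Longrightarrow> p a \<le> p l"
    and p_pos: "\<And>a. a \<in> arms K \<Longrightarrow> 0 < p a"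
    and p_sum: "(\<Sum>a\<in>arms K. p a) = 1"
    and p_out: "\<And>a. a \<notin> arms K \<Longrightarrow> p a = 0"
begin

abbreviation upd :: "nat \<Rightarrow> nat \<Rightarrow> real" where
  "upd b \<equiv> samba_update \<alpha> K l p b True"

lemma finite_arms: "finite (arms K)"
  by (simp add: arms_def)

lemma p_sum_others: "(\<Sum>a\<in>arms K - {x}. p a) = 1 - p x" if "x \<in> arms K" for x
  using p_sum sum.remove[OF finite_arms that, of p] by simp

lemma p_le_1: "a \<in> arms K \<Longrightarrow> p a \<le> 1"
  using p_sum p_pos member_le_sum[OF _ _ finite_arms, of a p] by fastforce

lemma K_pos: "real K > 0"
  using lead(1) by (auto simp: arms_def)

lemma lead_ge: "p l \<ge> 1 / K"
proof -
  have "1 \<le> (\<Sum>a\<in>arms K. p l)"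
    unfolding p_sum[symmetric] using lead(2) by (intro sum_mono) auto
  then show ?thesis
    using K_pos by (simp add: arms_def field_simps)
qed

lemma inv_lead_le: "1 / p l \<le> K"
  using lead_ge p_pos[OF lead(1)] K_pos by (simp add: field_simps)

lemma ratio_le_1: "a \<in> arms K \<Longrightarrow> p a / p l \<le> 1"
  using lead p_pos by simp

lemma ratio_le: "a \<in> arms K \<Longrightarrow> p a / p l \<le> K * p a"
  using mult_left_mono[OF inv_lead_le, of "p a"] p_pos[of a] by (simp add: mult.commute)

text \<open>This is the factor by which a rewarded pull of the leader shrinks \<open>p a\<close>;
  maximality of \<open>p l\<close> keeps it away from 0.\<close>

lemma damp_ge: "1 - \<alpha> * (p a / p l) \<ge> 1 - \<alpha>" if "a \<in> arms K" for a
  using mult_left_mono[OF ratio_le_1[OF that], of \<alpha>] \<alpha> by simp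

lemma no_reward: "samba_update \<alpha> K l p b False = p"
  using p_out lead(1) p_sum_others[OF lead(1)]
  by (auto simp: samba_update_def samba_nonlead_def fun_eq_iff)

lemma nonlead_True:
  assumes "a \<in> arms K" "a \<noteq> l"
  shows "samba_nonlead \<alpha> l p b True a =
    p a + (if b = a then \<alpha> * p a else 0) - (if b = l then \<alpha> * (p a)\<^sup>2 / p l else 0)"
  using p_pos[OF assms(1)] assms(2)
  by (auto simp: samba_nonlead_def field_simps power2_eq_square)

lemma upd_nonlead:
  assumes "a \<in> arms K" "a \<noteq> l"
  shows "upd a a = (1 + \<alpha>) * p a" "upd l a = p a * (1 - \<alpha> * (p a / p l))"
    "b \<noteq> a \<Longrightarrow> b \<noteq> l \<Longrightarrow> upd b a = p a"
  using assms by (auto simp: samba_update_def nonlead_True algebra_simps power2_eq_square)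

lemma upd_lead_lead: "upd l l = p l + \<alpha> * (\<Sum>a\<in>arms K - {l}. (p a)\<^sup>2) / p l"
proof -
  have "(\<Sum>a\<in>arms K - {l}. samba_nonlead \<alpha> l p l True a)
      = (\<Sum>a\<in>arms K - {l}. p a - \<alpha> * (p a)\<^sup>2 / p l)"
    by (intro sum.cong) (auto simp: nonlead_True)
  then show ?thesis
    using lead(1) p_sum_others[OF lead(1)]
    by (simp add: samba_update_def sum_subtractf sum_distrib_left sum_divide_distrib)
qed

lemma upd_nonlead_lead:
  assumes "b \<in> arms K" "b \<noteq> l"
  shows "upd b l = p l - \<alpha> * p b"
proof -
  have "(\<Sum>a\<in>arms K - {l}. samba_nonlead \<alpha> l p b True a)
      = (\<Sum>a\<in>arms K - {l}. p a + (if b = a then \<alpha> * p a else 0))"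
    using assms by (intro sum.cong) (auto simp: nonlead_True)
  then show ?thesis
    using assms lead(1) p_sum_others[OF lead(1)] finite_arms
    by (simp add: samba_update_def sum.distrib)
qed

lemma upd_sum: "(\<Sum>a\<in>arms K. upd b a) = 1"
  using lead(1) sum.remove[OF finite_arms lead(1), of "upd b"]
  by (simp add: samba_update_def)

lemma upd_out: "a \<notin> arms K \<Longrightarrow> upd b a = 0"
  by (simp add: samba_update_def)

text \<open>Additive control of \<open>1 / p a\<close> is what later gives a pathwise lower bound on
  \<open>p a\<close> of order 1/n. The leader keeps at least \<open>(1 - \<alpha>) * p l\<close>,
  where \<open>p l\<close> is at least \<open>1 / K\<close>. Any other arm loses mass only when the
  leader is rewarded, and then by a fraction proportional to \<open>p a\<close>.\<close>

lemma upd_inv: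
  assumes "a \<in> arms K" "b \<in> arms K"
  shows "0 < upd b a \<and> 1 / upd b a \<le> 1 / p a + K / (1 - \<alpha>)"
proof (cases "a = l")
  case True
  have *: "upd b l \<ge> (1 - \<alpha>) * p l"
  proof (cases "b = l")
    case True
    have "0 \<le> \<alpha> * (\<Sum>a\<in>arms K - {l}. (p a)\<^sup>2) / p l"
      using \<alpha> p_pos[OF lead(1)] by (intro divide_nonneg_pos mult_nonneg_nonneg sum_nonneg) auto
    moreover have "(1 - \<alpha>) * p l \<le> p l"
      using \<alpha> p_pos[OF lead(1)] by (simp add: algebra_simps)
    ultimately show ?thesis
      using True upd_lead_lead by simp
  next
    case False
    have "\<alpha> * p b \<le> \<alpha> * p l"
      using lead(2)[OF assms(2)] \<alpha> by (intro mult_left_mono) auto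
    then show ?thesis
      unfolding upd_nonlead_lead[OF assms(2) False] by (simp add: left_diff_distrib)
  qed
  have pos: "0 < (1 - \<alpha>) * p l"
    using \<alpha> p_pos[OF lead(1)] by simp
  have "1 / upd b l \<le> 1 / ((1 - \<alpha>) * p l)"
    using * pos by (intro divide_left_mono) auto
  also have "\<dots> = (1 / p l) / (1 - \<alpha>)"
    by simp
  also have "\<dots> \<le> K / (1 - \<alpha>)"
    using inv_lead_le \<alpha> by (intro divide_right_mono) auto
  finally show ?thesis
    using * pos True p_pos[OF lead(1)] by (simp add: add_increasing)
next
  case False
  note u = upd_nonlead[OF assms(1) False]
  have pa: "p a > 0"
    using p_pos assms by blast
  have Kn: "0 \<le> K / (1 - \<alpha>)"
    using \<alpha> by simp
  consider "b = a" | "b = l" | "b \<noteq> a" "b \<noteq> l" by blast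
  then show ?thesis
  proof cases
    case 1
    have "1 / ((1 + \<alpha>) * p a) \<le> 1 / p a"
      using \<alpha> pa by (intro divide_left_mono) auto
    then have "1 / ((1 + \<alpha>) * p a) \<le> 1 / p a + K / (1 - \<alpha>)"
      using Kn by linarith
    then show ?thesis
      using 1 u(1) \<alpha> pa by simp
  next
    case 2
    define y where "y = \<alpha> * (p a / p l)"
    have y: "1 - y \<ge> 1 - \<alpha>" "0 \<le> y"
      using damp_ge[OF assms(1)] \<alpha> pa p_pos[OF lead(1)] by (auto simp: y_def)
    \<comment> \<open>Since \<open>y\<close> is proportional to \<open>p a\<close>, the added term
      no longer depends on \<open>p a\<close> except through the denominator
      \<open>1 - y\<close>.\<close>
    have "1 / (p a * (1 - y)) = 1 / p a + (y / p a) / (1 - y)"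
      using y \<alpha> pa by (simp add: field_simps)
    also have "y / p a = \<alpha> * (1 / p l)"
      using pa by (simp add: y_def)
    also have "\<alpha> * (1 / p l) / (1 - y) \<le> K / (1 - \<alpha>)"
      using y \<alpha> inv_lead_le p_pos[OF lead(1)] mult_mono[of \<alpha> 1 "1 / p l" "real K"]
      by (intro frac_le) auto
    finally show ?thesis
      using 2 u(2)[folded y_def] y \<alpha> pa by auto
  next
    case 3
    then show ?thesis
      using u(3) pa Kn by auto
  qed
qed

lemma upd_pos: "a \<in> arms K \<Longrightarrow> b \<in> arms K \<Longrightarrow> 0 < upd b a"
  using upd_inv by blast

lemma upd_le_1: "a \<in> arms K \<Longrightarrow> b \<in> arms K \<Longrightarrow> upd b a \<le> 1"
  using upd_sum[of b] upd_pos member_le_sum[OF _ _ finite_arms, of a "upd b"] by fastforce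

section \<open>Drift: expected one-step change of a function of the state\<close>

text \<open>Only rewarded pulls contribute: the others leave \<open>p\<close> unchanged.\<close>

definition drift :: "(nat \<Rightarrow> real) \<Rightarrow> ((nat \<Rightarrow> real) \<Rightarrow> real) \<Rightarrow> real" where
  "drift m F = (\<Sum>b\<in>arms K. p b * m b * (F (upd b) - F p))"

lemma drift_diff: "drift m (\<lambda>q. F q - G q) = drift m F - drift m G"
  by (simp add: drift_def sum_subtractf[symmetric] algebra_simps)

lemma drift_add: "drift m (\<lambda>q. F q + G q) = drift m F + drift m G"
  by (simp add: drift_def sum.distrib[symmetric] algebra_simps)

lemma drift_cmult: "drift m (\<lambda>q. c * F q) = c * drift m F"
  by (simp add: drift_def sum_distrib_left algebra_simps)

lemma drift_sum: "drift m (\<lambda>q. \<Sum>i\<in>I. F i q) = (\<Sum>i\<in>I. drift m (F i))"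
  unfolding drift_def
  by (subst sum.swap) (simp add: sum_distrib_left[symmetric] sum_subtractf)

text \<open>A non-leading coordinate moves only when that arm or the leader is pulled. The function
  \<open>f\<close> is arbitrary so that the identity, the reciprocal and \<open>ln\<close> are all
  covered.\<close>

lemma drift_coord_nonlead:
  assumes a: "a \<in> arms K" "a \<noteq> l"
  shows "drift m (\<lambda>q. f (q a)) = p a * m a * (f ((1 + \<alpha>) * p a) - f (p a))
    + p l * m l * (f (p a * (1 - \<alpha> * (p a / p l))) - f (p a))"
proof -
  have "drift m (\<lambda>q. f (q a)) = (\<Sum>b\<in>{a, l}. p b * m b * (f (upd b a) - f (p a)))"
    unfolding drift_def using a lead(1) finite_arms upd_nonlead(3)[OF a]
    by (intro sum.mono_neutral_right) auto
  then show ?thesis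
    using a upd_nonlead[OF a] by simp
qed

lemma drift_lead_split:
  "drift m F = p l * m l * (F (upd l) - F p)
    + (\<Sum>b\<in>arms K - {l}. p b * m b * (F (upd b) - F p))"
  unfolding drift_def by (rule sum.remove[OF finite_arms lead(1)])

text \<open>A rewarded pull of the leader has weight \<open>p l * m l\<close> and gains a sum of
  squares divided by \<open>p l\<close>; a rewarded pull of \<open>b\<close> has weight
  \<open>p b * m b\<close> and costs \<open>\<alpha> * p b\<close>. Both give squares, so only
  differences of means remain.\<close>

lemma drift_lead_coord:
  "drift m (\<lambda>q. q l) = \<alpha> * (\<Sum>a\<in>arms K - {l}. (p a)\<^sup>2 * (m l - m a))"
proof -
  have "(\<Sum>b\<in>arms K - {l}. p b * m b * (upd b l - p l))
      = (\<Sum>b\<in>arms K - {l}. - (\<alpha> * (p b)\<^sup>2 * m b))"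
    by (intro sum.cong) (auto simp: upd_nonlead_lead power2_eq_square)
  moreover have "p l * m l * (upd l l - p l) = (\<Sum>b\<in>arms K - {l}. \<alpha> * (p b)\<^sup>2 * m l)"
    using p_pos[OF lead(1)] unfolding upd_lead_lead
    by (simp add: sum_distrib_left sum_distrib_right sum_divide_distrib algebra_simps)
  ultimately have "drift m (\<lambda>q. q l)
      = (\<Sum>b\<in>arms K - {l}. \<alpha> * (p b)\<^sup>2 * m l + - (\<alpha> * (p b)\<^sup>2 * m b))"
    unfolding drift_lead_split[of m "\<lambda>q. q l"] sum.distrib by simp
  then show ?thesis
    by (simp add: sum_distrib_left algebra_simps)
qed

end

section \<open>Drift estimates in a round with corrupted means \<open>m\<close> and corruption at
  most \<open>c\<close>\<close>

locale samba_step_adv = samba_env \<alpha> K r s D + samba_step \<alpha> K l p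
  for \<alpha> :: real and K :: nat and r :: "nat \<Rightarrow> real" and s :: nat and D :: real
    and l :: nat and p :: "nat \<Rightarrow> real" +
  fixes m :: "nat \<Rightarrow> real" and c :: real
  assumes m_range: "\<And>a. a \<in> arms K \<Longrightarrow> 0 \<le> m a" "\<And>a. a \<in> arms K \<Longrightarrow> m a \<le> 1"
    and m_close: "\<And>a. a \<in> arms K \<Longrightarrow> \<bar>r a - m a\<bar> \<le> c"
begin

lemma c_nonneg: "0 \<le> c"
  using m_close[OF star] by linarith

lemma m_gap: "a \<in> arms K \<Longrightarrow> a \<noteq> s \<Longrightarrow> D - 2 * c \<le> m s - m a"
  using m_close[OF star] m_close[of a] gap[of a] by linarith

lemma p_s: "0 < p s" "p s \<le> 1"
  using p_pos p_le_1 star by auto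

lemma pull_weights: "(\<Sum>b\<in>arms K. p b * m b) \<le> 1"
proof -
  have "(\<Sum>b\<in>arms K. p b * m b) \<le> (\<Sum>b\<in>arms K. p b)"
    using m_range p_pos by (intro sum_mono) (auto simp: mult_left_le less_imp_le)
  then show ?thesis
    using p_sum by simp
qed

lemma drift_le:
  assumes "\<And>b. b \<in> arms K \<Longrightarrow> F (upd b) - F p \<le> J" "0 \<le> J"
  shows "drift m F \<le> J"
proof -
  have "drift m F \<le> (\<Sum>b\<in>arms K. p b * m b * J)"
    unfolding drift_def using assms m_range p_pos
    by (intro sum_mono mult_left_mono) (auto simp: less_imp_le)
  also have "\<dots> = (\<Sum>b\<in>arms K. p b * m b) * J"
    by (simp add: sum_distrib_right)
  also have "\<dots> \<le> 1 * J"
    using pull_weights assms(2) by (intro mult_right_mono)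
  finally show ?thesis by simp
qed

text \<open>The common scale, while \<open>s\<close> leads, of the gain in \<open>p s\<close> and of
  the loss in \<open>1 / p s\<close>; this match lets \<open>coefB\<close> trade one for the
  other.\<close>

definition sq_others :: real where
  "sq_others = (\<Sum>a\<in>arms K - {s}. (p a)\<^sup>2)"

lemma sq_others_le_1: "sq_others \<le> 1"
proof -
  have "sq_others \<le> (\<Sum>a\<in>arms K - {s}. p a)"
    unfolding sq_others_def using p_pos p_le_1
    by (intro sum_mono) (auto simp: power2_eq_square mult_left_le less_imp_le)
  then show ?thesis
    using p_sum_others[OF star] p_s by simp
qed

lemma drift_star_lead:
  assumes "l = s"
  shows "drift m (\<lambda>q. q s) \<ge> \<alpha> * (D * sq_others - 2 * c)"
proof -
  \<comment> \<open>The corruption term is detached from the state by \<open>sq_others_le_1\<close>,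
    so that it can be summed against the budget.\<close>
  have "D * sq_others - 2 * c \<le> (D - 2 * c) * sq_others"
    using mult_left_mono[OF sq_others_le_1, of "2 * c"] c_nonneg by (simp add: algebra_simps)
  also have "\<dots> = (\<Sum>a\<in>arms K - {s}. (p a)\<^sup>2 * (D - 2 * c))"
    by (simp add: sq_others_def sum_distrib_left mult.commute)
  also have "\<dots> \<le> (\<Sum>a\<in>arms K - {s}. (p a)\<^sup>2 * (m s - m a))"
    using m_gap by (intro sum_mono mult_left_mono) auto
  finally show ?thesis
    using drift_lead_coord[of m] \<alpha> assms by simp
qed

lemma drift_star_nonlead:
  assumes "l \<noteq> s"
  shows "drift m (\<lambda>q. q s) \<ge> \<alpha> * (D * (p s)\<^sup>2 - 2 * c)"
proof -
  have "drift m (\<lambda>q. q s) = \<alpha> * ((p s)\<^sup>2 * (m s - m l))"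
    using drift_coord_nonlead[OF star, of m "\<lambda>x. x"] assms p_pos[OF lead(1)]
    by (simp add: field_simps power2_eq_square)
  moreover have "D * (p s)\<^sup>2 - 2 * c \<le> (D - 2 * c) * (p s)\<^sup>2"
    using mult_left_mono[of "(p s)\<^sup>2" 1 "2 * c"] c_nonneg p_s
    by (simp add: algebra_simps power_le_one)
  moreover have "(p s)\<^sup>2 * (D - 2 * c) \<le> (p s)\<^sup>2 * (m s - m l)"
    using m_gap[OF lead(1)] assms by (intro mult_left_mono) auto
  ultimately show ?thesis
    using \<alpha> by (simp add: mult.commute)
qed

text \<open>A rewarded pull of \<open>b\<close> has weight at most \<open>p b\<close> and raises
  \<open>1 / p s\<close> by order \<open>p b\<close>, because the leader \<open>s\<close> has
  \<open>p s\<close> at least \<open>1 / K\<close>; the product is of order \<open>(p b)^2\<close>.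
  Only \<open>m b \<le> 1\<close> enters, so no corruption term appears.\<close>

lemma drift_inv_lead:
  assumes "l = s"
  shows "drift m (\<lambda>q. 1 / q s) \<le> \<alpha> * (K\<^sup>2 / (1 - \<alpha>) * sq_others)"
proof -
  have "p b * m b * (1 / upd b s - 1 / p s) \<le> \<alpha> * (K\<^sup>2 / (1 - \<alpha>)) * (p b)\<^sup>2"
    if b: "b \<in> arms K - {s}" for b
  proof -
    have pb: "0 < p b"
      using b p_pos by blast
    have u: "upd b s = p s * (1 - \<alpha> * (p b / p s))"
      using upd_nonlead_lead[of b] b assms p_s by (simp add: algebra_simps)
    have y: "1 - \<alpha> * (p b / p s) \<ge> 1 - \<alpha>"
      using damp_ge b assms by auto
    have "1 / upd b s - 1 / p s = \<alpha> * p b * (1 / p s)\<^sup>2 / (1 - \<alpha> * (p b / p s))"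
    proof -
      have "1 - \<alpha> * (p b / p s) \<noteq> 0"
        using y \<alpha> by linarith
      then show ?thesis
        unfolding u using p_s by (simp add: field_simps power2_eq_square)
    qed
    also have "\<dots> \<le> \<alpha> * p b * K\<^sup>2 / (1 - \<alpha>)"
      using inv_lead_le assms y \<alpha> pb p_s
      by (intro frac_le mult_left_mono power_mono) auto
    finally have "p b * (1 / upd b s - 1 / p s) \<le> p b * (\<alpha> * p b * K\<^sup>2 / (1 - \<alpha>))"
      using pb by (intro mult_left_mono) auto
    moreover have "0 \<le> p b * (\<alpha> * p b * K\<^sup>2 / (1 - \<alpha>))"
      using pb \<alpha> by simp
    ultimately have "m b * (p b * (1 / upd b s - 1 / p s)) \<le> p b * (\<alpha> * p b * K\<^sup>2 / (1 - \<alpha>))"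
      using m_range[of b] b
      by (metis DiffD1 dual_order.trans mult_left_le_one_le mult_left_mono)
    then show ?thesis
      by (simp add: power2_eq_square mult_ac)
  qed
  then have "(\<Sum>b\<in>arms K - {s}. p b * m b * (1 / upd b s - 1 / p s))
      \<le> (\<Sum>b\<in>arms K - {s}. \<alpha> * (K\<^sup>2 / (1 - \<alpha>)) * (p b)\<^sup>2)"
    by (intro sum_mono)
  \<comment> \<open>A rewarded pull of \<open>s\<close> itself raises \<open>p s\<close>, so its
    contribution has the favourable sign and is dropped.\<close>
  moreover have "p s * m s * (1 / upd s s - 1 / p s) \<le> 0"
  proof -
    have "0 \<le> \<alpha> * (\<Sum>a\<in>arms K - {l}. (p a)\<^sup>2) / p l"
      using \<alpha> p_pos[OF lead(1)] by (intro divide_nonneg_pos mult_nonneg_nonneg sum_nonneg) auto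
    then have "1 / upd s s \<le> 1 / p s"
      using upd_lead_lead assms p_s by (intro divide_left_mono) auto
    then show ?thesis
      using p_s m_range[OF star] by (intro mult_nonneg_nonpos) auto
  qed
  ultimately show ?thesis
    using drift_lead_split[of m "\<lambda>q. 1 / q s"] assms
    by (simp add: sq_others_def sum_distrib_left mult.assoc)
qed

text \<open>Relative changes of \<open>p s\<close> become changes of \<open>1 / p s\<close> whose
  weighted size does not vanish with \<open>p s\<close>: rewards of \<open>s\<close> contribute
  exactly \<open>- \<alpha> * m s / (1 + \<alpha>)\<close>, rewards of the leader
  \<open>\<alpha> * m l\<close> plus a remainder of order \<open>p s\<close>. The two means may each
  be off by \<open>c\<close>.\<close>

lemma drift_inv_nonlead:
  assumes "l \<noteq> s"
  shows "drift m (\<lambda>q. 1 / q s) \<le> \<alpha> * (2 * c - slack + \<alpha> * K / (1 - \<alpha>) * p s)"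
proof -
  define x where "x = \<alpha> * (p s / p l)"
  have x: "1 - x \<ge> 1 - \<alpha>" "0 \<le> x"
    using damp_ge[OF star] \<alpha> p_s p_pos[OF lead(1)] by (auto simp: x_def)
  have x_le: "x \<le> \<alpha> * (K * p s)"
    unfolding x_def using ratio_le[OF star] \<alpha> by (intro mult_left_mono) auto
  have x1: "1 - x > 0"
    using x \<alpha> by linarith
  have "drift m (\<lambda>q. 1 / q s) = p s * m s * (1 / ((1 + \<alpha>) * p s) - 1 / p s)
      + p l * m l * (1 / (p s * (1 - x)) - 1 / p s)"
    using drift_coord_nonlead[OF star, of m "\<lambda>y. 1 / y"] assms by (simp add: x_def)
  also have "p s * m s * (1 / ((1 + \<alpha>) * p s) - 1 / p s) = m s * (1 / (1 + \<alpha>) - 1)"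
    using p_s by (simp add: right_diff_distrib)
  also have "1 / (1 + \<alpha>) - 1 = - \<alpha> / (1 + \<alpha>)"
    using \<alpha> by (simp add: field_simps)
  also have "p l * m l * (1 / (p s * (1 - x)) - 1 / p s) = p l / p s * x * (m l / (1 - x))"
    using p_s x1 by (simp add: field_simps)
  also have "p l / p s * x = \<alpha>"
    using p_s p_pos[OF lead(1)] by (simp add: x_def)
  also have "m l / (1 - x) = m l + m l * (x / (1 - x))"
    using x1 by (simp add: field_simps)
  finally have d: "drift m (\<lambda>q. 1 / q s)
      = \<alpha> * (m l + m l * (x / (1 - x)) - m s / (1 + \<alpha>))"
    by (simp add: algebra_simps)
  have "m l * (x / (1 - x)) \<le> x / (1 - x)"
    using m_range[OF lead(1)] x x1 by (intro mult_left_le_one_le) auto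
  also have "\<dots> \<le> \<alpha> * (K * p s) / (1 - \<alpha>)"
    using x x_le \<alpha> p_s by (intro frac_le) auto
  finally have 1: "m l * (x / (1 - x)) \<le> \<alpha> * K / (1 - \<alpha>) * p s"
    by simp
  have 2: "m l \<le> r s - D + c"
    using m_close[OF lead(1)] gap[OF lead(1)] assms by linarith
  have "r s / (1 + \<alpha>) - c \<le> r s / (1 + \<alpha>) - c / (1 + \<alpha>)"
    using c_nonneg \<alpha> divide_left_mono[of 1 "1 + \<alpha>" c] by simp
  also have "\<dots> = (r s - c) / (1 + \<alpha>)"
    by (simp add: diff_divide_distrib)
  also have "\<dots> \<le> m s / (1 + \<alpha>)"
    using m_close[OF star] \<alpha> by (intro divide_right_mono) auto
  finally show ?thesis
    unfolding d using 1 2 \<alpha> by (intro mult_left_mono) (auto simp: slack_def)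
qed

text \<open>The inequality \<open>ln (1 + u) \<le> u\<close> is applied to both moves of
  \<open>p a\<close>; the weights then match, leaving \<open>\<alpha> * p a * (m a - m s)\<close>.
  Unlike the squares above, this is linear in \<open>p a\<close> and therefore controls the
  regret.\<close>

lemma drift_ln_lead:
  assumes "l = s"
  shows "drift m (\<lambda>q. \<Sum>a\<in>arms K - {s}. ln (q a)) \<le> \<alpha> * (2 * c - D * (1 - p s))"
proof -
  have "drift m (\<lambda>q. ln (q a)) \<le> (\<alpha> * (2 * c - D)) * p a" if a: "a \<in> arms K - {s}" for a
  proof -
    have pa: "0 < p a" and al: "a \<in> arms K" "a \<noteq> l"
      using a p_pos assms by auto
    define y where "y = \<alpha> * (p a / p s)"
    have y: "1 - y > 0"
      using damp_ge[OF al(1)] assms \<alpha> by (simp add: y_def)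
    have "ln (1 + \<alpha>) \<le> \<alpha>" "ln (1 - y) \<le> - y"
      using ln_add_one_self_le_self[of \<alpha>] ln_le_minus_one[OF y] \<alpha> by auto
    then have "p a * m a * ln (1 + \<alpha>) + p s * m s * ln (1 - y)
        \<le> p a * m a * \<alpha> + p s * m s * (- y)"
      using pa p_s m_range al star by (intro add_mono mult_left_mono) auto
    also have "\<dots> = \<alpha> * p a * (m a - m s)"
      using p_s by (simp add: y_def algebra_simps)
    also have "\<dots> \<le> \<alpha> * p a * (2 * c - D)"
      using m_gap[of a] a \<alpha> pa by (intro mult_left_mono) auto
    finally show ?thesis
      using drift_coord_nonlead[OF al, of m ln] pa y \<alpha> assms
      by (simp add: y_def ln_mult_pos mult.commute mult.left_commute)
  qed
  then have "drift m (\<lambda>q. \<Sum>a\<in>arms K - {s}. ln (q a))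
      \<le> (\<Sum>a\<in>arms K - {s}. (\<alpha> * (2 * c - D)) * p a)"
    unfolding drift_sum by (intro sum_mono)
  also have "\<dots> = \<alpha> * ((2 * c - D) * (1 - p s))"
    using p_sum_others[OF star] by (simp add: sum_distrib_left[symmetric])
  also have "\<dots> \<le> \<alpha> * (2 * c - D * (1 - p s))"
    using p_s c_nonneg \<alpha> by (intro mult_left_mono) (auto simp: algebra_simps)
  finally show ?thesis .
qed

lemma upd_growth:
  assumes "a \<in> arms K" "b \<in> arms K"
  shows "upd b a \<le> (1 + K) * p a"
proof (cases "a = l")
  case True
  then show ?thesis
    using upd_le_1[OF assms] inv_lead_le p_pos[OF lead(1)] by (simp add: field_simps)
next
  case False
  note u = upd_nonlead[OF assms(1) False]
  have pa: "0 < p a" and K1: "1 \<le> real K"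
    using p_pos assms K_pos by auto
  have "0 \<le> \<alpha> * (p a / p l)"
    using \<alpha> pa p_pos[OF lead(1)] by simp
  then have "p a * (1 - \<alpha> * (p a / p l)) \<le> p a * (1 + K)" "p a * (1 + \<alpha>) \<le> p a * (1 + K)"
    using pa \<alpha> K1 by (auto intro!: mult_left_mono)
  moreover have "p a \<le> p a * (1 + K)"
    using pa by simp
  ultimately show ?thesis
    using u by (cases "b = a"; cases "b = l") (auto simp: mult.commute)
qed

text \<open>A crude bound whichever arm leads, needed when \<open>s\<close> does not lead and the
  logarithms may grow. The factor \<open>1 + K\<close> of \<open>upd_growth\<close> is chosen so
  that each logarithm rises by at most \<open>ln (1 + K) \<le> K\<close>.\<close>

lemma drift_ln: "drift m (\<lambda>q. \<Sum>a\<in>arms K - {s}. ln (q a)) \<le> K\<^sup>2"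
proof (rule drift_le)
  fix b assume b: "b \<in> arms K"
  have "ln (upd b a) - ln (p a) \<le> K" if "a \<in> arms K" for a
  proof -
    have "ln (upd b a) \<le> ln (1 + K) + ln (p a)"
      using upd_growth[OF that b] upd_pos[OF that b] p_pos[OF that]
      by (simp add: ln_mult_pos[symmetric])
    then show ?thesis
      using ln_add_one_self_le_self[of "real K"] by simp
  qed
  then have "(\<Sum>a\<in>arms K - {s}. ln (upd b a) - ln (p a)) \<le> (\<Sum>a\<in>arms K - {s}. real K)"
    by (intro sum_mono) auto
  also have "\<dots> \<le> (\<Sum>a\<in>arms K. real K)"
    using finite_arms by (intro sum_mono2) auto
  also have "\<dots> = K\<^sup>2"
    by (simp add: arms_def power2_eq_square)
  finally show "(\<Sum>a\<in>arms K - {s}. ln (upd b a)) - (\<Sum>a\<in>arms K - {s}. ln (p a)) \<le> K\<^sup>2"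
    by (simp add: sum_subtractf)
qed auto

lemma drift_potential: "drift m potential \<le> \<alpha> * (cost_rate * c - D * (1 - p s))"
proof -
  let ?ln = "\<lambda>q. \<Sum>a\<in>arms K - {s}. ln (q a)"
  have eq: "drift m potential = coefA * (drift m (\<lambda>q. 1 / q s) - coefB * drift m (\<lambda>q. q s)) + drift m ?ln"
    unfolding potential_def[abs_def] drift_add drift_cmult drift_diff by simp
  have A: "coefA * slack = 2 * (K\<^sup>2 / \<alpha> + D)"
    using slack_pos \<alpha> by (simp add: coefA_def field_simps)
  have BD: "coefB * D = K\<^sup>2 / (1 - \<alpha>) + (\<alpha> * K / (1 - \<alpha>))\<^sup>2 / (2 * slack)"
    using D by (simp add: coefB_def)
  show ?thesis
  proof (cases "l = s")
    case True
    have "K\<^sup>2 / (1 - \<alpha>) \<le> coefB * D"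
      using BD slack_pos by simp
    then have *: "K\<^sup>2 / (1 - \<alpha>) * sq_others \<le> coefB * D * sq_others"
      by (intro mult_right_mono) (auto simp: sq_others_def sum_nonneg)
    have "drift m (\<lambda>q. 1 / q s) - coefB * drift m (\<lambda>q. q s)
        \<le> \<alpha> * (K\<^sup>2 / (1 - \<alpha>) * sq_others) - coefB * (\<alpha> * (D * sq_others - 2 * c))"
      using drift_inv_lead[OF True] drift_star_lead[OF True] coef_pos
      by (intro diff_mono mult_left_mono)
    also have "\<dots> = \<alpha> * (K\<^sup>2 / (1 - \<alpha>) * sq_others - coefB * D * sq_others + 2 * coefB * c)"
      by (simp add: algebra_simps)
    also have "\<dots> \<le> \<alpha> * (2 * (1 + coefB) * c)"
      using * c_nonneg \<alpha> by (intro mult_left_mono) (auto simp: algebra_simps)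
    finally have "coefA * (drift m (\<lambda>q. 1 / q s) - coefB * drift m (\<lambda>q. q s))
        \<le> coefA * (\<alpha> * (2 * (1 + coefB) * c))"
      using coef_pos by (intro mult_left_mono) auto
    then have "drift m potential
        \<le> coefA * (\<alpha> * (2 * (1 + coefB) * c)) + \<alpha> * (2 * c - D * (1 - p s))"
      unfolding eq using drift_ln_lead[OF True] by simp
    then show ?thesis
      by (simp add: cost_rate_def algebra_simps)
  next
    case False
    define L where "L = \<alpha> * K / (1 - \<alpha>)"
    \<comment> \<open>Young's inequality from a completed square: the linear error is split into
      half of the slack and a multiple of \<open>(p s)^2\<close>, the order of the drift of
      \<open>p s\<close>.\<close>
    have "0 \<le> (L * p s - slack)\<^sup>2 / (2 * slack)"
      using slack_pos by simp
    also have "\<dots> = L\<^sup>2 / (2 * slack) * (p s)\<^sup>2 - L * p s + slack / 2"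
      using slack_pos by (simp add: power2_eq_square field_simps)
    finally have "L * p s \<le> slack / 2 + L\<^sup>2 / (2 * slack) * (p s)\<^sup>2"
      by simp
    moreover have "L\<^sup>2 / (2 * slack) * (p s)\<^sup>2 \<le> coefB * D * (p s)\<^sup>2"
      using BD \<alpha> by (intro mult_right_mono) (auto simp: L_def)
    ultimately have *: "L * p s \<le> slack / 2 + coefB * D * (p s)\<^sup>2"
      by linarith
    have "drift m (\<lambda>q. 1 / q s) - coefB * drift m (\<lambda>q. q s)
        \<le> \<alpha> * (2 * c - slack + L * p s) - coefB * (\<alpha> * (D * (p s)\<^sup>2 - 2 * c))"
      using drift_inv_nonlead[OF False] drift_star_nonlead[OF False] coef_pos
      unfolding L_def by (intro diff_mono mult_left_mono)
    also have "\<dots> = \<alpha> * (2 * (1 + coefB) * c - slack + (L * p s - coefB * D * (p s)\<^sup>2))"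
      by (simp add: algebra_simps)
    also have "\<dots> \<le> \<alpha> * (2 * (1 + coefB) * c - slack / 2)"
      using * \<alpha> by (intro mult_left_mono) auto
    finally have "coefA * (drift m (\<lambda>q. 1 / q s) - coefB * drift m (\<lambda>q. q s))
        \<le> coefA * (\<alpha> * (2 * (1 + coefB) * c - slack / 2))"
      using coef_pos by (intro mult_left_mono) auto
    also have "\<dots> = \<alpha> * (2 * coefA * (1 + coefB) * c) - \<alpha> * (coefA * slack) / 2"
      by (simp add: algebra_simps)
    also have "\<dots> = \<alpha> * (2 * coefA * (1 + coefB) * c) - K\<^sup>2 - \<alpha> * D"
      unfolding A using \<alpha> by (simp add: algebra_simps)
    finally have "drift m potential \<le> \<alpha> * (2 * coefA * (1 + coefB) * c) - \<alpha> * D"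
      unfolding eq using drift_ln by linarith
    also have "\<dots> = \<alpha> * (2 * coefA * (1 + coefB) * c - D)"
      by (simp add: algebra_simps)
    \<comment> \<open>The full \<open>D\<close> is weakened to \<open>D * (1 - p s)\<close> so that
      both cases end in the same bound.\<close>
    also have "\<dots> \<le> \<alpha> * (cost_rate * c - D * (1 - p s))"
      using \<alpha> c_nonneg p_s D
      by (intro mult_left_mono) (auto simp: cost_rate_def algebra_simps add_nonneg_nonneg)
    finally show ?thesis .
  qed
qed

end

section \<open>Histories\<close>

locale samba_run = samba_env +
  fixes tb :: "history \<Rightarrow> (nat \<Rightarrow> real) \<Rightarrow> nat" and adv :: "history \<Rightarrow> nat \<Rightarrow> real"
  assumes tb: "\<And>h q. tb h q \<in> arms K" "\<And>h q a. a \<in> arms K \<Longrightarrow> q a \<le> q (tb h q)"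
    and adv: "\<And>h a. a \<in> arms K \<Longrightarrow> 0 \<le> adv h a" "\<And>h a. a \<in> arms K \<Longrightarrow> adv h a \<le> 1"
begin

abbreviation P :: "history \<Rightarrow> nat \<Rightarrow> real" where
  "P \<equiv> samba_probs \<alpha> K tb"

abbreviation hist :: "nat \<Rightarrow> history pmf" where
  "hist \<equiv> samba_hist \<alpha> K tb adv"

lemma P_Nil: "P [] = (\<lambda>a. if a \<in> arms K then 1 / real K else 0)"
  by (simp add: samba_probs_def)

lemma P_snoc: "P (h @ [(b, R)]) = samba_update \<alpha> K (tb h (P h)) (P h) b R"
  by (simp add: samba_probs_def Let_def)

text \<open>A pathwise induction over all reward sequences, independent of the adversary. Validity
  and the bound on \<open>1 / P h a\<close> go together because \<open>upd_inv\<close> supplies both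
  positivity and the increment.\<close>

lemma step_valid:
  assumes "h \<in> lists (arms K \<times> UNIV)"
  shows "samba_step \<alpha> K (tb h (P h)) (P h)
    \<and> (\<forall>a\<in>arms K. 1 / P h a \<le> (length h + 1) * (K / (1 - \<alpha>)))"
  using assms
proof (induction h rule: rev_induct)
  case Nil
  have K: "0 < real K"
    using star by (auto simp: arms_def)
  \<comment> \<open>The initial value \<open>K\<close> is counted as one more increment, whence
    \<open>length h + 1\<close>.\<close>
  then have "real K \<le> K / (1 - \<alpha>)"
    using \<alpha> by (simp add: field_simps)
  moreover have "samba_step \<alpha> K (tb [] (P [])) (P [])"
    using \<alpha> tb K by unfold_locales (auto simp: P_Nil arms_def split: if_splits)
  ultimately show ?case
    by (auto simp: P_Nil)
next
  case (snoc x h)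
  obtain b R where x: "x = (b, R)" "b \<in> arms K"
    using snoc.prems by auto
  have IH: "samba_step \<alpha> K (tb h (P h)) (P h)"
      "\<And>a. a \<in> arms K \<Longrightarrow> 1 / P h a \<le> (length h + 1) * (K / (1 - \<alpha>))"
    using snoc by auto
  interpret samba_step \<alpha> K "tb h (P h)" "P h"
    by (rule IH)
  have Kn: "0 \<le> K / (1 - \<alpha>)"
    using \<alpha> by simp
  show ?case
  proof (cases R)
    case True
    have "samba_step \<alpha> K (tb (h @ [x]) (P (h @ [x]))) (P (h @ [x]))"
      using \<alpha> tb upd_pos upd_sum upd_out x True
      by unfold_locales (auto simp: P_snoc)
    moreover have "1 / P (h @ [x]) a \<le> (length (h @ [x]) + 1) * (K / (1 - \<alpha>))"
      if "a \<in> arms K" for a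
    proof -
      have "1 / P (h @ [x]) a \<le> 1 / P h a + K / (1 - \<alpha>)"
        using upd_inv[OF that x(2)] x True by (simp add: P_snoc)
      also have "\<dots> \<le> (length h + 1) * (K / (1 - \<alpha>)) + K / (1 - \<alpha>)"
        using IH(2)[OF that] by (rule add_right_mono)
      also have "\<dots> = (length (h @ [x]) + 1) * (K / (1 - \<alpha>))"
        by (simp add: distrib_right add_divide_distrib)
      finally show ?thesis .
    qed
    ultimately show ?thesis by blast
  next
    case False
    have eq: "P (h @ [x]) = P h"
      using no_reward x False by (simp add: P_snoc)
    \<comment> \<open>The vector is unchanged, but ties may be broken differently after the longer
      history, so the conditions on the leader are checked afresh.\<close>
    have "samba_step \<alpha> K (tb (h @ [x]) (P h)) (P h)"
      using \<alpha> tb p_pos p_sum p_out by unfold_locales auto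
    moreover have "1 / P h a \<le> (length (h @ [x]) + 1) * (K / (1 - \<alpha>))"
      if "a \<in> arms K" for a
    proof -
      have "(length h + 1) * (K / (1 - \<alpha>)) \<le> (length (h @ [x]) + 1) * (K / (1 - \<alpha>))"
        using Kn by (intro mult_right_mono) auto
      then show ?thesis
        using IH(2)[OF that] by linarith
    qed
    ultimately show ?thesis
      unfolding eq by blast
  qed
qed

lemma step_adv:
  assumes "h \<in> lists (arms K \<times> UNIV)"
  shows "samba_step_adv \<alpha> K r s D (tb h (P h)) (P h) (adv h) (corruption_cost K r (adv h))"
proof -
  interpret samba_step \<alpha> K "tb h (P h)" "P h"
    using step_valid[OF assms] by blast
  show ?thesis
    using adv finite_arms by unfold_locales (auto simp: corruption_cost_def intro!: Max_ge)
qed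

text \<open>\<open>embed_pmf\<close> has the intended masses only for a nonnegative vector of total
  mass 1, which \<open>step_valid\<close> guarantees along histories of genuine arms.\<close>

lemma pmf_pull:
  assumes "h \<in> lists (arms K \<times> UNIV)"
  shows "pmf (embed_pmf (P h)) a = P h a" "set_pmf (embed_pmf (P h)) = arms K"
proof -
  interpret samba_step \<alpha> K "tb h (P h)" "P h"
    using step_valid[OF assms] by blast
  have nn: "0 \<le> P h a" for a
    using p_pos p_out by (cases "a \<in> arms K") (auto simp: less_imp_le)
  have "(\<integral>\<^sup>+ a. ennreal (P h a) \<partial>count_space UNIV) = (\<Sum>a\<in>arms K. ennreal (P h a))"
    using finite_arms p_out nn by (intro nn_integral_count_space') (auto simp: ennreal_neg)
  also have "\<dots> = 1"
    using nn p_sum by (simp add: sum_ennreal)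
  finally have tot: "(\<integral>\<^sup>+ a. ennreal (P h a) \<partial>count_space UNIV) = 1" .
  show "pmf (embed_pmf (P h)) a = P h a"
    by (rule pmf_embed_pmf[OF nn tot])
  have "set_pmf (embed_pmf (P h)) = {x. P h x \<noteq> 0}"
    by (rule set_embed_pmf[OF nn tot])
  then show "set_pmf (embed_pmf (P h)) = arms K"
    using p_pos p_out by force
qed

text \<open>Finite support makes every function of the history integrable and turns expectations
  into finite sums.\<close>

lemma hist_support:
  "finite (set_pmf (hist n)) \<and> set_pmf (hist n) \<subseteq> {h \<in> lists (arms K \<times> UNIV). length h = n}"
proof (induction n)
  case (Suc n)
  then have *: "set_pmf (embed_pmf (P h)) = arms K" if "h \<in> set_pmf (hist n)" for h
    using pmf_pull that by blast
  have "finite (set_pmf (hist (Suc n)))"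
    using Suc * by (auto simp: arms_def)
  moreover have "h \<in> lists (arms K \<times> UNIV) \<and> length h = Suc n" if "h \<in> set_pmf (hist (Suc n))" for h
    using that Suc * by fastforce
  ultimately show ?case by blast
qed auto

lemma integrable_hist: "integrable (hist n) (f :: history \<Rightarrow> real)"
  using hist_support by (intro integrable_measure_pmf_finite) auto

section \<open>Telescoping the potential\<close>

lemma expectation_hist_Suc:
  "measure_pmf.expectation (hist (Suc n)) f = (\<Sum>h\<in>set_pmf (hist n). pmf (hist n) h *
     (\<Sum>b\<in>arms K. P h b * (adv h b * f (h @ [(b, True)]) + (1 - adv h b) * f (h @ [(b, False)]))))"
  for f :: "history \<Rightarrow> real"
proof -
  have fin: "finite (arms K)"
    by (simp add: arms_def)
  have sup: "h \<in> lists (arms K \<times> UNIV)" if "h \<in> set_pmf (hist n)" for h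
    using hist_support that by blast
  have "measure_pmf.expectation (bind_pmf (embed_pmf (P h))
        (\<lambda>b. map_pmf (\<lambda>R. h @ [(b, R)]) (bernoulli_pmf (adv h b)))) f
      = (\<Sum>b\<in>arms K. P h b * (adv h b * f (h @ [(b, True)]) + (1 - adv h b) * f (h @ [(b, False)])))"
    if "h \<in> set_pmf (hist n)" for h
    using pmf_pull[OF sup[OF that]] fin adv
    by (subst pmf_expectation_bind[where A = "arms K"]) (auto simp: mult.commute intro!: sum.cong)
  moreover have "finite (set_pmf (bind_pmf (embed_pmf (P h))
        (\<lambda>b. map_pmf (\<lambda>R. h @ [(b, R)]) (bernoulli_pmf (adv h b)))))"
    if "h \<in> set_pmf (hist n)" for h
    using pmf_pull[OF sup[OF that]] fin by auto
  ultimately show ?thesis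
    using hist_support[of n]
    by (subst samba_hist.simps, subst pmf_expectation_bind[where A = "set_pmf (hist n)"]) auto
qed

text \<open>Supermartingale argument: the accumulated sum compensates the drift bound of
  \<open>drift_potential\<close>, so the expectation cannot increase from round to round.\<close>

lemma expected_potential:
  "measure_pmf.expectation (hist n) (\<lambda>h. potential (P h) + (\<Sum>t<n. \<alpha> *
     (D * (1 - P (take t h) s) - cost_rate * corruption_cost K r (adv (take t h))))) \<le> potential (P [])"
proof (induction n)
  case (Suc n)
  let ?g = "\<lambda>h. \<alpha> * (D * (1 - P h s) - cost_rate * corruption_cost K r (adv h))"
  let ?f = "\<lambda>n h. potential (P h) + (\<Sum>t<n. ?g (take t h))"
  have "(\<Sum>b\<in>arms K. P h b * (adv h b * ?f (Suc n) (h @ [(b, True)])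
      + (1 - adv h b) * ?f (Suc n) (h @ [(b, False)]))) \<le> ?f n h"
    if h: "h \<in> set_pmf (hist n)" for h
  proof -
    have sup: "h \<in> lists (arms K \<times> UNIV)" "length h = n"
      using hist_support h by auto
    interpret samba_step_adv \<alpha> K r s D "tb h (P h)" "P h" "adv h" "corruption_cost K r (adv h)"
      by (rule step_adv[OF sup(1)])
    \<comment> \<open>The first \<open>n\<close> entries of the extended history are those of
      \<open>h\<close>, so the compensator is the same for every outcome of the new round.\<close>
    define G where "G = (\<Sum>t<n. ?g (take t h)) + ?g h"
    have "(\<Sum>t<Suc n. ?g (take t (h @ [x]))) = G" for x
      using sup(2) by (simp add: G_def)
    then have f: "?f (Suc n) (h @ [x]) = potential (P (h @ [x])) + G" for x
      by (rule arg_cong)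
    have "(\<Sum>b\<in>arms K. P h b * (adv h b * ?f (Suc n) (h @ [(b, True)])
        + (1 - adv h b) * ?f (Suc n) (h @ [(b, False)])))
      = (\<Sum>b\<in>arms K. P h b * (potential (P h) + G)
          + P h b * adv h b * (potential (upd b) - potential (P h)))"
      unfolding f unfolding P_snoc no_reward by (intro sum.cong) (auto simp: algebra_simps)
    also have "\<dots> = potential (P h) + G + drift (adv h) potential"
      using p_sum by (simp add: drift_def sum.distrib sum_distrib_right[symmetric])
    also have "\<dots> \<le> ?f n h"
      using drift_potential by (simp add: G_def algebra_simps)
    finally show ?thesis .
  qed
  then have "measure_pmf.expectation (hist (Suc n)) (?f (Suc n))
      \<le> (\<Sum>h\<in>set_pmf (hist n). pmf (hist n) h * ?f n h)"
    unfolding expectation_hist_Suc by (intro sum_mono mult_left_mono) auto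
  also have "\<dots> = measure_pmf.expectation (hist n) (?f n)"
    using hist_support[of n] by (subst integral_measure_pmf[of "set_pmf (hist n)"]) auto
  also have "\<dots> \<le> potential (P [])"
    by (rule Suc.IH)
  finally show ?case .
qed simp

lemma potential_Nil_le: "potential (P []) \<le> coefA * K"
proof -
  have K: "1 \<le> real K"
    using star by (auto simp: arms_def)
  have "(\<Sum>a\<in>arms K - {s}. ln (P [] a)) \<le> 0"
    using K by (intro sum_nonpos) (auto simp: P_Nil ln_div)
  moreover have "coefA * (1 / P [] s - coefB * P [] s) \<le> coefA * K"
    using coef_pos K star by (intro mult_left_mono) (auto simp: P_Nil)
  ultimately show ?thesis
    by (simp add: potential_def)
qed

lemma potential_ge:
  assumes "h \<in> lists (arms K \<times> UNIV)"
  shows "potential (P h) \<ge> - (coefA * coefB) - K * ln ((length h + 1) * (K / (1 - \<alpha>)))"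
proof -
  interpret samba_step \<alpha> K "tb h (P h)" "P h"
    using step_valid[OF assms] by blast
  let ?Y = "(length h + 1) * (K / (1 - \<alpha>))"
  have inv: "1 / P h a \<le> ?Y" if "a \<in> arms K" for a
    using step_valid[OF assms] that by blast
  have "1 \<le> 1 / P h s"
    using p_pos p_le_1 star by simp
  \<comment> \<open>This sign allows the sum over the suboptimal arms to be extended to all
    \<open>K\<close> arms in the lower bound.\<close>
  then have lnY: "0 \<le> ln ?Y"
    using inv[OF star] by (intro ln_ge_zero) linarith
  have "- ln ?Y \<le> ln (P h a)" if "a \<in> arms K" for a
  proof -
    have "ln (1 / P h a) \<le> ln ?Y"
      using inv[OF that] p_pos[OF that] by (subst ln_le_cancel_iff) (auto intro: order.strict_trans2[of 0 "1 / P h a"])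
    then show ?thesis
      using p_pos[OF that] by (simp add: ln_div)
  qed
  then have "(\<Sum>a\<in>arms K - {s}. - ln ?Y) \<le> (\<Sum>a\<in>arms K - {s}. ln (P h a))"
    by (intro sum_mono) auto
  moreover have "(\<Sum>a\<in>arms K. - ln ?Y) \<le> (\<Sum>a\<in>arms K - {s}. - ln ?Y)"
    using finite_arms star lnY by (subst sum.remove[of _ s]) auto
  moreover have "(\<Sum>a\<in>arms K. - ln ?Y) = - (K * ln ?Y)"
    by (simp add: arms_def)
  moreover have "- (coefA * coefB) \<le> coefA * (1 / P h s - coefB * P h s)"
  proof -
    have "- coefB \<le> 1 / P h s - coefB * P h s"
      using coef_pos p_pos[OF star] p_le_1[OF star] mult_left_le[of "P h s" coefB]
      by (smt (verit) divide_pos_pos)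
    then show ?thesis
      using coef_pos mult_left_mono[of "- coefB" _ coefA] by fastforce
  qed
  ultimately show ?thesis
    unfolding potential_def by linarith
qed

text \<open>The lower bound on the potential and the corruption budget both hold on every history in
  the support, so they are inserted pathwise before taking expectations.\<close>

lemma expected_off_star:
  assumes C: "\<And>h. h \<in> set_pmf (hist n) \<Longrightarrow> (\<Sum>i<n. corruption_cost K r (adv (take i h))) \<le> C"
  shows "\<alpha> * D * measure_pmf.expectation (hist n) (\<lambda>h. \<Sum>t<n. 1 - P (take t h) s)
    \<le> coefA * K + coefA * coefB + K * ln ((n + 1) * (K / (1 - \<alpha>))) + \<alpha> * cost_rate * C"
proof -
  let ?f = "\<lambda>h. potential (P h) + (\<Sum>t<n. \<alpha> *
     (D * (1 - P (take t h) s) - cost_rate * corruption_cost K r (adv (take t h))))"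
  let ?Q = "\<lambda>h. \<Sum>t<n. 1 - P (take t h) s"
  define Z where "Z = coefA * coefB + K * ln ((n + 1) * (K / (1 - \<alpha>))) + \<alpha> * cost_rate * C"
  have "\<alpha> * D * ?Q h \<le> ?f h + Z" if h: "h \<in> set_pmf (hist n)" for h
  proof -
    have "- (coefA * coefB) - K * ln ((n + 1) * (K / (1 - \<alpha>))) \<le> potential (P h)"
      using potential_ge[of h] hist_support h by auto
    moreover have "\<alpha> * cost_rate * (\<Sum>i<n. corruption_cost K r (adv (take i h))) \<le> \<alpha> * cost_rate * C"
      using C[OF h] \<alpha> cost_rate_pos by (intro mult_left_mono) auto
    moreover have "(\<Sum>t<n. \<alpha> * (D * (1 - P (take t h) s)
        - cost_rate * corruption_cost K r (adv (take t h))))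
      = \<alpha> * D * ?Q h - \<alpha> * cost_rate * (\<Sum>i<n. corruption_cost K r (adv (take i h)))"
      unfolding sum_distrib_left sum_subtractf[symmetric] by (simp add: right_diff_distrib mult.assoc)
    ultimately show ?thesis
      unfolding Z_def by linarith
  qed
  then have "measure_pmf.expectation (hist n) (\<lambda>h. \<alpha> * D * ?Q h)
      \<le> measure_pmf.expectation (hist n) (\<lambda>h. ?f h + Z)"
    by (intro integral_mono_AE integrable_hist) (simp add: AE_measure_pmf_iff)
  also have "\<dots> = measure_pmf.expectation (hist n) ?f + Z"
    by (subst Bochner_Integration.integral_add) (auto intro: integrable_hist)
  also have "\<dots> \<le> coefA * K + Z"
    using expected_potential[of n] potential_Nil_le by linarith
  finally show ?thesis
    by (simp add: Z_def algebra_simps)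
qed

text \<open>Every gap is at most 1, and the probabilities of the suboptimal arms add up to
  \<open>1 - P h s\<close>.\<close>

lemma regret_le_off_star:
  "samba_regret \<alpha> K tb adv r s n \<le> measure_pmf.expectation (hist n) (\<lambda>h. \<Sum>t<n. 1 - P (take t h) s)"
proof -
  have "samba_regret \<alpha> K tb adv r s n = measure_pmf.expectation (hist n)
      (\<lambda>h. \<Sum>a\<in>arms K - {s}. (r s - r a) * (\<Sum>t<n. P (take t h) a))"
    unfolding samba_regret_def
    by (subst Bochner_Integration.integral_sum) (auto intro: integrable_hist)
  also have "\<dots> \<le> measure_pmf.expectation (hist n) (\<lambda>h. \<Sum>t<n. 1 - P (take t h) s)"
  proof (intro integral_mono_AE integrable_hist, simp only: AE_measure_pmf_iff, intro ballI)
    fix h assume "h \<in> set_pmf (hist n)"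
    then have sup: "take t h \<in> lists (arms K \<times> UNIV)" for t
      using hist_support[of n] by (auto dest!: in_set_takeD)
    have nn: "0 \<le> P (take t h) a" if "a \<in> arms K" for t a
      using step_valid[OF sup, of t] samba_step.p_pos[of \<alpha> K _ "P (take t h)"] that
      by (meson less_imp_le)
    have "(\<Sum>a\<in>arms K - {s}. (r s - r a) * (\<Sum>t<n. P (take t h) a))
        \<le> (\<Sum>a\<in>arms K - {s}. (\<Sum>t<n. P (take t h) a))"
    proof (intro sum_mono mult_left_le_one_le)
      fix a assume a: "a \<in> arms K - {s}"
      show "0 \<le> (\<Sum>t<n. P (take t h) a)"
        using nn a by (intro sum_nonneg) auto
      show "0 \<le> r s - r a" "r s - r a \<le> 1"
        using r_range(1)[of a] r_range(2)[OF star] gap[of a] a D by auto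
    qed
    also have "\<dots> = (\<Sum>t<n. \<Sum>a\<in>arms K - {s}. P (take t h) a)"
      by (rule sum.swap)
    also have "\<dots> = (\<Sum>t<n. 1 - P (take t h) s)"
      using samba_step.p_sum_others[OF conjunct1[OF step_valid[OF sup]] star]
      by (intro sum.cong) auto
    finally show "(\<Sum>a\<in>arms K - {s}. (r s - r a) * (\<Sum>t<n. P (take t h) a))
        \<le> (\<Sum>t<n. 1 - P (take t h) s)" .
  qed
  finally show ?thesis .
qed

end

section \<open>The regret bound\<close>

theorem theorem1:
  fixes K :: nat and r :: "nat \<Rightarrow> real" and astar :: nat and \<alpha> :: real
  assumes K2: "K \<ge> 2"
    and r_range: "\<forall>a\<in>arms K. 0 \<le> r a \<and> r a \<le> 1"
    and astar: "astar \<in> arms K"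
    and unique: "\<forall>a\<in>arms K - {astar}. r a < r astar"
    and alpha: "0 < \<alpha>" "\<alpha> < 1"
    and alpha_gap: "\<alpha> * (r astar - Min ((\<lambda>a. r astar - r a) ` (arms K - {astar})))
                      < Min ((\<lambda>a. r astar - r a) ` (arms K - {astar}))"
  shows "\<exists>c1>0. \<exists>c2>0. \<forall>tb adv (C::real) (T::nat).
           (\<forall>h p. tb h p \<in> arms K \<and> (\<forall>a\<in>arms K. p a \<le> p (tb h p))) \<longrightarrow>
           (\<forall>h a. a \<in> arms K \<longrightarrow> 0 \<le> adv h a \<and> adv h a \<le> 1) \<longrightarrow>
           C \<ge> 0 \<longrightarrow>
           (\<forall>n. \<forall>h\<in>set_pmf (samba_hist \<alpha> K tb adv n).
               (\<Sum>i<n. corruption_cost K r (adv (take i h))) \<le> C) \<longrightarrow>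
           T \<ge> 2 \<longrightarrow>
           samba_regret \<alpha> K tb adv r astar T
             \<le> c1 * real K / Min ((\<lambda>a. r astar - r a) ` (arms K - {astar})) * ln (real T)
               + c2 * C / Min ((\<lambda>a. r astar - r a) ` (arms K - {astar}))"
proof -
  define D where "D = Min ((\<lambda>a. r astar - r a) ` (arms K - {astar}))"
  have fin: "finite (arms K - {astar})"
    by (simp add: arms_def)
  have "\<not> arms K \<subseteq> {astar}"
    using K2 card_mono[of "{astar}" "arms K"] by (auto simp: arms_def)
  then have "D \<in> (\<lambda>a. r astar - r a) ` (arms K - {astar})"
    unfolding D_def using fin by (intro Min_in) auto
  then have D0: "0 < D"
    using unique by auto
  have D_le: "D \<le> r astar - r a" if "a \<in> arms K" "a \<noteq> astar" for a
    unfolding D_def using fin that by (intro Min_le) auto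
  interpret samba_env \<alpha> K r astar D
    using alpha astar r_range D_le D0 alpha_gap
    by unfold_locales (force simp: D_def[symmetric])+
  \<comment> \<open>\<open>H\<close> gathers the terms free of \<open>T\<close> and
    \<open>C\<close>. Then \<open>c1\<close> is chosen so that
    \<open>\<alpha> * K * c1 = H / ln 2 + 2 * K\<close>, while \<open>cost_rate\<close> serves as
    the second constant; all are fixed before \<open>tb\<close>, \<open>adv\<close>,
    \<open>C\<close> and \<open>T\<close>.\<close>
  define H where "H = coefA * K + coefA * coefB + K * ln (K / (1 - \<alpha>))"
  define c1 where "c1 = (H / ln 2 + 2 * K) / (\<alpha> * K)"
  have lnK: "0 \<le> ln (K / (1 - \<alpha>))"
    using K2 alpha by (intro ln_ge_zero) (simp add: field_simps)
  have H: "0 \<le> H"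
    using coef_pos lnK by (simp add: H_def)
  have c1: "0 < c1"
    using H K2 alpha unfolding c1_def by (intro divide_pos_pos add_nonneg_pos) auto
  have "samba_regret \<alpha> K tb adv r astar T \<le> c1 * real K / D * ln (real T) + cost_rate * C / D"
    if tb: "\<forall>h p. tb h p \<in> arms K \<and> (\<forall>a\<in>arms K. p a \<le> p (tb h p))"
      and adv: "\<forall>h a. a \<in> arms K \<longrightarrow> 0 \<le> adv h a \<and> adv h a \<le> 1"
      and C: "\<forall>n. \<forall>h\<in>set_pmf (samba_hist \<alpha> K tb adv n).
               (\<Sum>i<n. corruption_cost K r (adv (take i h))) \<le> C"
      and T: "T \<ge> 2"
    for tb adv C T
  proof -
    interpret samba_run \<alpha> K r astar D tb adv
      using tb adv by unfold_locales auto
    \<comment> \<open>The assumption \<open>T \<ge> 2\<close> is used twice: to absorb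
      \<open>H\<close> into a multiple of \<open>ln T\<close>, and to replace
      \<open>ln (T + 1)\<close> by \<open>2 * ln T\<close>.\<close>
    have lnT: "1 \<le> ln T / ln 2"
      using T by simp
    have "real (T + 1) \<le> (real T)\<^sup>2"
      using T mult_right_mono[of 2 "real T" "real T"] unfolding power2_eq_square by linarith
    then have "ln (real (T + 1)) \<le> ln ((real T)\<^sup>2)"
      using T by (subst ln_le_cancel_iff) auto
    also have "\<dots> = 2 * ln T"
      using T by (simp add: ln_realpow)
    finally have "ln ((T + 1) * (K / (1 - \<alpha>))) \<le> 2 * ln T + ln (K / (1 - \<alpha>))"
      using K2 alpha by (subst ln_mult_pos) auto
    then have "K * ln ((T + 1) * (K / (1 - \<alpha>))) \<le> K * (2 * ln T + ln (K / (1 - \<alpha>)))"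
      by (intro mult_left_mono) auto
    then have "\<alpha> * D * measure_pmf.expectation (hist T) (\<lambda>h. \<Sum>t<T. 1 - P (take t h) astar)
        \<le> H + 2 * K * ln T + \<alpha> * cost_rate * C"
      using expected_off_star[of T C] C unfolding H_def by (simp add: algebra_simps)
    also have "H \<le> H * (ln T / ln 2)"
      using mult_left_mono[OF lnT H] by simp
    also have "H * (ln T / ln 2) + 2 * K * ln T = \<alpha> * K * c1 * ln T"
      using K2 alpha by (simp add: c1_def field_simps)
    finally have "measure_pmf.expectation (hist T) (\<lambda>h. \<Sum>t<T. 1 - P (take t h) astar)
        \<le> (\<alpha> * K * c1 * ln T + \<alpha> * cost_rate * C) / (\<alpha> * D)"
      using alpha D0 by (simp add: pos_le_divide_eq mult.commute)
    also have "\<dots> = c1 * real K / D * ln (real T) + cost_rate * C / D"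
      using alpha D0 by (simp add: field_simps)
    finally show ?thesis
      using regret_le_off_star[of T] by linarith
  qed
  then show ?thesis
    unfolding D_def[symmetric] using c1 cost_rate_pos by blast
qed

end
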